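(* Let $X,Z,V$ represent the meta-Hahn algebra on a real vector space $\mathfrak V_N$ of dimension $N+1$ with scalar product $(\cdot,\cdot)$, let $\{e_m\}_{m=0}^N$ be the eigenbasis of $V$ and $\{d^*_n\}_{n=0}^N$ the adjoint GEVP basis. Then the function $U_m(n)=(e_m,d^*_n)$ satisfies, for all $m,n=0,\dots,N$, the recurrence relation of GEVP form $$X^{(e)}_{m+1,m}U_{m+1}(n)+X^{(e)}_{m,m}U_m(n)+X^{(e)}_{m-1,m}U_{m-1}(n)=(\alpha-n)\left[Z^{(e)}_{m+1,m}U_{m+1}(n)+Z^{(e)}_{m,m}U_m(n)+Z^{(e)}_{m-1,m}U_{m-1}(n)\right].$$
   Context: $[A,B]=AB-BA$, $\{A,B\}=AB+BA$. Representing the meta-Hahn algebra (real parameters $\eta_0,\eta_1,\eta_3$) means that $$[Z,X]=Z^2+Z,\qquad [X,V]=\{V,Z\}+\eta_1X+V-\eta_1Z+\eta_0\mathcal I,\qquad [V,Z]=2X+\eta_1Z+\eta_3\mathcal I .$$ $A^T$ is the transpose of $A$ with respect to the scalar product. The adjoint GEVP basis satisfies $X^Td^*_n=(\alpha-n)Z^Td^*_n$ for some real $\alpha$. The eigenbasis of $V$ satisfies $Ve_m=\nu_me_m$, $\nu_m=-m(m-\eta_1-1)$, and $X,Z$ act tridiagonally on it: $$Xe_m=X^{(e)}_{m+1,m}e_{m+1}+X^{(e)}_{m,m}e_m+X^{(e)}_{m-1,m}e_{m-1},\qquad Ze_m=Z^{(e)}_{m+1,m}e_{m+1}+Z^{(e)}_{m,m}e_m+Z^{(e)}_{m-1,m}e_{m-1},$$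 with $X^{(e)}_{-1,0}=X^{(e)}_{N+1,N}=Z^{(e)}_{-1,0}=Z^{(e)}_{N+1,N}=0$. Terms with index $-1$ or $N+1$ are zero. *)

theory Defs
  imports "HOL-Analysis.Analysis"
begin

definition commutator :: "('a \<Rightarrow> 'a) \<Rightarrow> ('a \<Rightarrow> 'a) \<Rightarrow> 'a \<Rightarrow> 'a::real_vector" where
  "commutator A B = (\<lambda>v. A (B v) - B (A v))"

definition anticommutator :: "('a \<Rightarrow> 'a) \<Rightarrow> ('a \<Rightarrow> 'a) \<Rightarrow> 'a \<Rightarrow> 'a::real_vector" where
  "anticommutator A B = (\<lambda>v. A (B v) + B (A v))"

definition meta_Hahn_rep ::
  "real \<Rightarrow> real \<Rightarrow> real \<Rightarrow> ('a \<Rightarrow> 'a) \<Rightarrow> ('a \<Rightarrow> 'a) \<Rightarrow> ('a \<Rightarrow> 'a::real_vector) \<Rightarrow> bool" where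
  "meta_Hahn_rep \<eta>0 \<eta>1 \<eta>3 X Z V \<longleftrightarrow>
     linear X \<and> linear Z \<and> linear V \<and>
     (\<forall>v. commutator Z X v = Z (Z v) + Z v) \<and>
     (\<forall>v. commutator X V v =
        anticommutator V Z v + \<eta>1 *\<^sub>R X v + V v - \<eta>1 *\<^sub>R Z v + \<eta>0 *\<^sub>R v) \<and>
     (\<forall>v. commutator V Z v = 2 *\<^sub>R X v + \<eta>1 *\<^sub>R Z v + \<eta>3 *\<^sub>R v)"

text \<open>
  Families are indexed by integers so that the boundary indices -1 and N + 1 can be written
  literally. Only the values at 0, ..., N are constrained; a boundary vector always occurs with a
  coefficient that is required to vanish.
\<close>

definition basis_family :: "nat \<Rightarrow> (int \<Rightarrow> 'a::real_vector) \<Rightarrow> bool" where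
  "basis_family N b \<longleftrightarrow>
     inj_on b {0..int N} \<and> independent (b ` {0..int N}) \<and> span (b ` {0..int N}) = UNIV"

definition V_eigenbasis ::
  "nat \<Rightarrow> real \<Rightarrow> ('a \<Rightarrow> 'a) \<Rightarrow> (int \<Rightarrow> 'a::real_vector) \<Rightarrow> bool" where
  "V_eigenbasis N \<eta>1 V e \<longleftrightarrow>
     basis_family N e \<and>
     (\<forall>m\<in>{0..int N}. V (e m) = (- of_int m * (of_int m - \<eta>1 - 1)) *\<^sub>R e m)"

definition adjoint_GEVP_basis ::
  "nat \<Rightarrow> real \<Rightarrow> ('a \<Rightarrow> 'a) \<Rightarrow> ('a \<Rightarrow> 'a) \<Rightarrow> (int \<Rightarrow> 'a::euclidean_space) \<Rightarrow> bool" where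
  "adjoint_GEVP_basis N \<alpha> X Z d \<longleftrightarrow>
     basis_family N d \<and>
     (\<forall>n\<in>{0..int N}. adjoint X (d n) = (\<alpha> - of_int n) *\<^sub>R adjoint Z (d n))"

text \<open>The coefficient \<open>C k m\<close> is the entry in row \<open>k\<close> and column \<open>m\<close> of the matrix of \<open>A\<close>.\<close>

definition tridiagonal_action ::
  "nat \<Rightarrow> (int \<Rightarrow> 'a::real_vector) \<Rightarrow> ('a \<Rightarrow> 'a) \<Rightarrow> (int \<Rightarrow> int \<Rightarrow> real) \<Rightarrow> bool" where
  "tridiagonal_action N e A C \<longleftrightarrow>
     (\<forall>m\<in>{0..int N}.
        A (e m) = C (m + 1) m *\<^sub>R e (m + 1) + C m m *\<^sub>R e m + C (m - 1) m *\<^sub>R e (m - 1)) \<and>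
     C (- 1) 0 = 0 \<and> C (int N + 1) (int N) = 0"

definition overlap :: "(int \<Rightarrow> 'a::real_inner) \<Rightarrow> (int \<Rightarrow> 'a) \<Rightarrow> int \<Rightarrow> int \<Rightarrow> real" where
  "overlap e d m n = e m \<bullet> d n"

end

theory Submission imports Defs begin

text \<open>The number \<open>X (e m) \<bullet> d n\<close> is computed in two ways. Expanding
  \<open>X (e m)\<close> in the basis \<open>e\<close> gives the left-hand side. Moving
  \<open>X\<close> onto \<open>d n\<close> as an adjoint, trading it for
  \<open>(\<alpha> - n)\<close> times the adjoint of \<open>Z\<close>, and moving \<open>Z\<close>
  back gives \<open>(\<alpha> - n) * (Z (e m) \<bullet> d n)\<close>, whose expansion is the
  right-hand side.\<close>

text \<open>Linearity of the scalar product in its first argument. The ends \<open>m = 0\<close> and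
  \<open>m = N\<close> need no case split, since the boundary terms appear formally on both
  sides.\<close>

lemma inner_tridiagonal_action:
  assumes "tridiagonal_action N e A C" and "m \<in> {0..int N}"
  shows "A (e m) \<bullet> d n =
    C (m + 1) m * overlap e d (m + 1) n + C m m * overlap e d m n + C (m - 1) m * overlap e d (m - 1) n"
  using assms by (simp add: tridiagonal_action_def overlap_def inner_add_left)

theorem proposition5p1:
  fixes N :: nat
    and \<eta>0 \<eta>1 \<eta>3 \<alpha> :: real
    and X Z V :: "'a::euclidean_space \<Rightarrow> 'a"
    and e d :: "int \<Rightarrow> 'a"
    and Xe Ze :: "int \<Rightarrow> int \<Rightarrow> real"
    and U :: "int \<Rightarrow> int \<Rightarrow> real"
    and m n :: int
  assumes "DIM('a) = N + 1"
    and "meta_Hahn_rep \<eta>0 \<eta>1 \<eta>3 X Z V"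
    and "V_eigenbasis N \<eta>1 V e"
    and "tridiagonal_action N e X Xe"
    and "tridiagonal_action N e Z Ze"
    and "adjoint_GEVP_basis N \<alpha> X Z d"
    and "U = overlap e d"
    and "m \<in> {0..int N}"
    and "n \<in> {0..int N}"
  shows "Xe (m + 1) m * U (m + 1) n + Xe m m * U m n + Xe (m - 1) m * U (m - 1) n =
    (\<alpha> - of_int n) *
      (Ze (m + 1) m * U (m + 1) n + Ze m m * U m n + Ze (m - 1) m * U (m - 1) n)"
proof -
  have linear: "linear X" "linear Z"
    using assms(2) by (simp_all add: meta_Hahn_rep_def)
  have "X (e m) \<bullet> d n = e m \<bullet> adjoint X (d n)"
    using adjoint_works[OF linear(1)] by simp
  also have "\<dots> = (\<alpha> - of_int n) * (e m \<bullet> adjoint Z (d n))"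
    using assms(6,9) by (simp add: adjoint_GEVP_basis_def)
  also have "\<dots> = (\<alpha> - of_int n) * (Z (e m) \<bullet> d n)"
    using adjoint_works[OF linear(2)] by simp
  \<comment> \<open>\<open>X\<close> and \<open>Z\<close> act on the same vector \<open>e m\<close>,
    so both expansions involve the same three overlaps.\<close>
  finally show ?thesis
    using assms(8) by (simp only: assms(7) inner_tridiagonal_action[OF assms(4)]
        inner_tridiagonal_action[OF assms(5)])
qed

end
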